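(* Let $A, B, B_1,\ldots,B_m$ be $n\times n$ positive semidefinite matrices such that $A=B+\sum_{i\leqslant m}B_i$ is of rank $n$. Then for any $k\geqslant n-\lfloor \mathrm{Tr}(A^{-1}B)\rfloor$, there exists $\sigma_k\subset\{1,\ldots,m\}$ of size $k$ such that $$\mathrm{Tr}\left(A_{\sigma_k}^{-1}\right)\leqslant \mathrm{Tr}\left(A^{-1}\right)\cdot\left[\frac{m-n+\mathrm{Tr}(A^{-1}B)+1}{k-n+1+\mathrm{Tr}(A^{-1}B)}\right]-\frac{(m-k)\cdot\mathrm{Tr}(A^{-2}B)}{k-n+1+\mathrm{Tr}(A^{-1}B)},$$ where $A_{\sigma_k}=B+\sum_{i\in\sigma_k}B_i$. In particular, there exists $\sigma\subset\{1,\ldots,m\}$ with $|\sigma|=n-\lfloor\mathrm{Tr}(A^{-1}B)\rfloor$ such that $$\mathrm{Tr}\left(A_{\sigma}^{-1}\right)\leqslant \left(m-n+1+\mathrm{Tr}(A^{-1}B)\right)\cdot\mathrm{Tr}\left(A^{-1}\right)-\mathrm{Tr}(A^{-2}B)\left(m-n+\mathrm{Tr}(A^{-1}B)\right),$$ where $A_\sigma=B+\sum_{i\in\sigma}B_i$.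
   Context: All matrices are real; positive semidefinite matrices are symmetric. $\lfloor x\rfloor$ denotes the integer part (floor) of $x$, $\mathrm{Tr}$ the trace, and $|\sigma|$ the number of elements of $\sigma$.
   Formalization: The condition k ≤ m is added in the first part and n − ⌊Tr(A⁻¹B)⌋ ≤ m in the second; otherwise no subset of that size exists (e.g. n = 2, m = 1, B = 0, B₁ = I). *)

theory Defs
  imports "HOL-Analysis.Analysis"
begin

definition psd_matrix :: "real^'n^'n \<Rightarrow> bool" where
  "psd_matrix M \<longleftrightarrow> transpose M = M \<and> (\<forall>x. 0 \<le> x \<bullet> (M *v x))"

text \<open>
  \<^const>\<open>matrix_inv\<close> has an unspecified value at a singular matrix, so a bound on
  \<open>trace (matrix_inv M)\<close> has to be accompanied by \<open>invertible M\<close> to be meaningful.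
\<close>

end

theory Submission
  imports Defs
begin

text \<open>
  The subset is found greedily, deleting one index at a time. For \<open>A = B + (\<Sum>i\<in>\<sigma>. B\<^sub>i)\<close> put
  \<open>T = Tr A\<^sup>-\<^sup>1\<close>, \<open>S = Tr (A\<^sup>-\<^sup>2 B)\<close> and \<open>\<kappa> = k - n + 1 + Tr (A\<^sup>-\<^sup>1 B)\<close>. The bound to be proved is the
  potential \<open>T + r (T - S) / \<kappa>\<close>, where \<open>r\<close> indices remain to be deleted, and some deletion does not
  increase it. After a congruence \<open>A = 1\<close>, and the traces are taken against a semidefinite matrix
  \<open>H\<close>. Then \<open>(1 - B\<^sub>i)\<^sup>-\<^sup>1 \<le> 1 + B\<^sub>i / w\<^sub>i\<close> with \<open>w\<^sub>i = 1 - Tr B\<^sub>i\<close>, and averaging the increment of the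
  potential over the indices with \<open>w\<^sub>i > 0\<close>, with the weights \<open>w\<^sub>i\<close>, gives a nonpositive number.
  The term \<open>S\<close> is not monotone under deletion; what controls it is the inequality
  \<open>V F + F V \<le> V + F\<close> for \<open>0 \<le> F \<le> V \<le> 1\<close>.
\<close>

subsection \<open>Matrix algebra\<close>

lemma matrix_add_rdistrib: "(B + C) ** A = B ** A + C ** A"
  for A :: "'a::semiring_1^'n^'m"
  by (vector matrix_matrix_mult_def sum.distrib[symmetric] distrib_right)

lemma matrix_diff_ldistrib: "A ** (B - C) = A ** B - A ** C"
  for A :: "'a::ring_1^'n^'m"
  by (vector matrix_matrix_mult_def sum_subtractf[symmetric] right_diff_distrib)

lemma matrix_diff_rdistrib: "(B - C) ** A = B ** A - C ** A"
  for A :: "'a::ring_1^'n^'m"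
  by (vector matrix_matrix_mult_def sum_subtractf[symmetric] left_diff_distrib)

lemma matrix_sum_ldistrib: "A ** (\<Sum>i\<in>I. F i) = (\<Sum>i\<in>I. A ** F i)"
  for A :: "'a::semiring_1^'n^'m"
  by (induction I rule: infinite_finite_induct) (simp_all add: matrix_add_ldistrib)

lemma matrix_sum_rdistrib: "(\<Sum>i\<in>I. F i) ** A = (\<Sum>i\<in>I. F i ** A)"
  for A :: "'a::semiring_1^'n^'m"
  by (induction I rule: infinite_finite_induct) (simp_all add: matrix_add_rdistrib)

lemma matrix_scaleR_left: "(k *\<^sub>R A) ** B = k *\<^sub>R (A ** B)"
  for A :: "real^'n^'m"
  by (simp add: scalar_matrix_assoc)

lemma matrix_scaleR_right: "A ** (k *\<^sub>R B) = k *\<^sub>R (A ** B)"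
  for A :: "real^'n^'m"
  by (simp add: matrix_scalar_ac scalar_matrix_assoc)

lemma trace_scaleR: "trace (k *\<^sub>R A) = k * trace A"
  for A :: "real^'n^'n"
  by (simp add: trace_def sum_distrib_left)

lemma trace_zero [simp]: "trace (0::real^'n^'n) = 0"
  by (simp add: trace_def)

lemma trace_sum: "trace (\<Sum>i\<in>I. F i) = (\<Sum>i\<in>I. trace (F i))"
  for F :: "'i \<Rightarrow> real^'n^'n"
  by (induction I rule: infinite_finite_induct) (simp_all add: trace_add)

lemma transpose_add: "transpose (A + B) = transpose A + transpose B"
  by (simp add: transpose_def vec_eq_iff)

lemma transpose_diff: "transpose (A - B) = transpose A - transpose B"
  for A :: "'a::ab_group_add^'n^'m"
  by (simp add: transpose_def vec_eq_iff)

lemma transpose_zero [simp]: "transpose 0 = 0"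
  by (simp add: transpose_def vec_eq_iff)

lemmas mat_distribs =
  matrix_add_ldistrib matrix_add_rdistrib matrix_diff_ldistrib matrix_diff_rdistrib
  matrix_scaleR_left matrix_scaleR_right matrix_mul_assoc[symmetric]

lemmas trace_linear = trace_add trace_sub trace_scaleR

lemmas transpose_distribs =
  transpose_diff transpose_scalar matrix_transpose_mul transpose_mat

subsection \<open>Positive semidefinite matrices\<close>

lemma inner_matrix_vector: "x \<bullet> (A *v y) = (transpose A *v x) \<bullet> y"
  for A :: "real^'n^'m"
  by (simp add: dot_lmul_matrix)

lemma psd_matrixI:
  "\<lbrakk>transpose M = M; \<And>x. 0 \<le> x \<bullet> (M *v x)\<rbrakk> \<Longrightarrow> psd_matrix M"
  by (simp add: psd_matrix_def)

lemma psd_transpose: "psd_matrix M \<Longrightarrow> transpose M = M"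
  by (simp add: psd_matrix_def)

lemma psd_nonneg: "psd_matrix M \<Longrightarrow> 0 \<le> x \<bullet> (M *v x)"
  by (simp add: psd_matrix_def)

lemma psd_zero [simp]: "psd_matrix 0"
  by (simp add: psd_matrix_def)

lemma psd_one [simp]: "psd_matrix (mat 1)"
  by (simp add: psd_matrix_def)

lemma psd_add: "\<lbrakk>psd_matrix M; psd_matrix N\<rbrakk> \<Longrightarrow> psd_matrix (M + N)"
  by (simp add: psd_matrix_def transpose_add algebra_simps inner_add_right)

lemma psd_sum: "(\<And>i. i \<in> I \<Longrightarrow> psd_matrix (F i)) \<Longrightarrow> psd_matrix (\<Sum>i\<in>I. F i)"
  by (induction I rule: infinite_finite_induct) (auto intro: psd_add)

lemma psd_scaleR: "\<lbrakk>psd_matrix M; 0 \<le> c\<rbrakk> \<Longrightarrow> psd_matrix (c *\<^sub>R M)"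
  by (simp add: psd_matrix_def transpose_scalar scaleR_matrix_vector_assoc[symmetric])

lemma psd_congruence: "psd_matrix M \<Longrightarrow> psd_matrix (Q ** M ** transpose Q)"
  for Q :: "real^'n^'m"
proof (rule psd_matrixI)
  assume M: "psd_matrix M"
  show "transpose (Q ** M ** transpose Q) = Q ** M ** transpose Q"
    by (simp add: matrix_transpose_mul psd_transpose[OF M] matrix_mul_assoc)
  fix x
  have "x \<bullet> ((Q ** M ** transpose Q) *v x) = x \<bullet> (Q *v (M *v (transpose Q *v x)))"
    by (simp only: matrix_vector_mul_assoc matrix_mul_assoc)
  also have "\<dots> = (transpose Q *v x) \<bullet> (M *v (transpose Q *v x))"
    by (rule inner_matrix_vector)
  finally show "0 \<le> x \<bullet> ((Q ** M ** transpose Q) *v x)"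
    using psd_nonneg[OF M] by simp
qed

lemma psd_conj_symmetric:
  "\<lbrakk>psd_matrix M; transpose Q = Q\<rbrakk> \<Longrightarrow> psd_matrix (Q ** M ** Q)"
  using psd_congruence[of M Q] by simp

text \<open>With \<open>y = M *v x\<close>, the form along \<open>x - s *\<^sub>R y\<close> is
  \<open>s * s * b - 2 * s * a\<close>, where \<open>a = y \<bullet> y\<close>. If \<open>y\<close>
  is nonzero, this is negative for small positive \<open>s\<close>.\<close>

lemma psd_kernel:
  assumes M: "psd_matrix M" and x: "x \<bullet> (M *v x) = 0"
  shows "M *v x = 0"
proof (rule ccontr)
  let ?y = "M *v x"
  assume "?y \<noteq> 0"
  hence yy: "?y \<bullet> ?y > 0" by simp
  define a where "a = ?y \<bullet> ?y"
  define b where "b = ?y \<bullet> (M *v ?y)"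
  have b: "b \<ge> 0" unfolding b_def by (rule psd_nonneg[OF M])
  have sym: "x \<bullet> (M *v ?y) = ?y \<bullet> ?y"
    using inner_matrix_vector[of x M ?y] psd_transpose[OF M] by simp
  have "0 \<le> (x - s *\<^sub>R ?y) \<bullet> (M *v (x - s *\<^sub>R ?y))" for s
    by (rule psd_nonneg[OF M])
  hence *: "0 \<le> s * s * b - 2 * s * a" for s
    using x sym
    by (simp add: a_def b_def algebra_simps inner_diff_left inner_diff_right inner_commute)
  show False
  proof (cases "b = 0")
    case True
    with *[of 1] yy show False by (simp add: a_def)
  next
    case False
    with b have "b > 0" by simp
    have "a / b * (a / b) * b - 2 * (a / b) * a = - (a * a / b)"
      using \<open>b > 0\<close> by (simp add: field_simps)
    moreover have "a * a / b > 0" using yy \<open>b > 0\<close> by (simp add: a_def)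
    ultimately show False using *[of "a / b"] by linarith
  qed
qed

section \<open>Sums of rank-one squares and the factorization
  \<open>R ** transpose R\<close>\<close>

definition outer_square :: "real^'n \<Rightarrow> real^'n^'n" where
  "outer_square v = (\<chi> i j. v $ i * v $ j)"

lemma outer_square_mult_vector: "outer_square v *v x = (v \<bullet> x) *\<^sub>R v"
  by (simp add: outer_square_def matrix_vector_mult_def vec_eq_iff inner_vec_def
      sum_distrib_left sum_distrib_right mult_ac)

lemma transpose_outer_square: "transpose (outer_square v) = outer_square v"
  by (simp add: outer_square_def transpose_def vec_eq_iff mult.commute)

text \<open>Symmetric elimination: subtracting a suitable rank-one square keeps \<open>M\<close>
  semidefinite and moves a vector \<open>x\<close> with \<open>M *v x \<noteq> 0\<close> into the
  kernel. The second hypothesis says that the rank is at most \<open>d\<close>, and the induction is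
  on that bound.\<close>

lemma psd_sum_outer_squares:
  fixes M :: "real^'n^'n"
  assumes "psd_matrix M" and "CARD('n) \<le> d + dim {x. M *v x = 0}"
  shows "\<exists>v :: nat \<Rightarrow> real^'n. M = (\<Sum>j<d. outer_square (v j))"
  using assms
proof (induction d arbitrary: M)
  case 0
  have "subspace {x. M *v x = 0}"
    by (auto simp: subspace_def algebra_simps)
  moreover have "dim {x. M *v x = 0} = DIM(real^'n)"
    using 0 dim_subset_UNIV[of "{x. M *v x = 0}"] by simp
  ultimately have "{x. M *v x = 0} = UNIV"
    by (metis dim_eq_full span_eq_iff)
  hence "M = 0" by (auto simp: matrix_eq)
  thus ?case by simp
next
  case (Suc d)
  note M = \<open>psd_matrix M\<close>
  show ?case
  proof (cases "M = 0")
    case True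
    have "outer_square 0 = (0::real^'n^'n)" by (simp add: outer_square_def vec_eq_iff)
    \<comment> \<open>Since \<open>d\<close> may exceed the rank, the sum is padded with zero
      vectors.\<close>
    with True show ?thesis by (intro exI[of _ "\<lambda>_. 0"]) simp
  next
    case False
    then obtain x where x: "M *v x \<noteq> 0" by (auto simp: matrix_eq)
    define q where "q = x \<bullet> (M *v x)"
    have q: "q > 0"
      using psd_kernel[OF M, of x] psd_nonneg[OF M, of x] x unfolding q_def by force
    \<comment> \<open>This scaling makes \<open>outer_square u *v x\<close> equal to
      \<open>M *v x\<close>.\<close>
    define u where "u = (1 / sqrt q) *\<^sub>R (M *v x)"
    have sym: "y \<bullet> (M *v z) = (M *v y) \<bullet> z" for y z
      using inner_matrix_vector[of y M z] psd_transpose[OF M] by simp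
    have uy: "(u \<bullet> y) * (u \<bullet> y) = (x \<bullet> (M *v y))\<^sup>2 / q" for y
      using q sym[of x y] by (simp add: u_def power2_eq_square)
    define N where "N = M - outer_square u"
    have Nv: "N *v y = M *v y - (u \<bullet> y) *\<^sub>R u" for y
      by (simp add: N_def algebra_simps outer_square_mult_vector)
    have "psd_matrix N"
    proof (rule psd_matrixI)
      show "transpose N = N"
        by (simp add: N_def transpose_diff psd_transpose[OF M] transpose_outer_square)
      fix y
      define c where "c = x \<bullet> (M *v y)"
      have c: "y \<bullet> (M *v x) = c" unfolding c_def using sym[of x y] inner_commute[of y "M *v x"] by simp
      \<comment> \<open>Completing the square: \<open>c / q\<close> minimizes the form of
        \<open>M\<close> along \<open>y - s *\<^sub>R x\<close>, and the minimum is the form of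
        \<open>N\<close> at \<open>y\<close>.\<close>
      have "0 \<le> (y - (c / q) *\<^sub>R x) \<bullet> (M *v (y - (c / q) *\<^sub>R x))"
        by (rule psd_nonneg[OF M])
      also have "\<dots> = y \<bullet> (M *v y) - 2 * (c / q) * c + (c / q) * (c / q) * q"
        using c by (simp add: algebra_simps inner_diff_left inner_diff_right
            q_def[symmetric] c_def[symmetric])
      also have "\<dots> = y \<bullet> (M *v y) - c\<^sup>2 / q"
        using q by (simp add: power2_eq_square)
      also have "\<dots> = y \<bullet> (N *v y)"
        using uy[of y] by (simp add: Nv inner_diff_right c_def inner_commute)
      finally show "0 \<le> y \<bullet> (N *v y)" .
    qed
    moreover have "CARD('n) \<le> d + dim {x. N *v x = 0}"
    proof -
      have sub: "subspace {x. M *v x = 0}" "subspace {x. N *v x = 0}"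
        by (auto simp: subspace_def algebra_simps)
      have "u \<bullet> x = sqrt q"
        using q by (simp add: u_def q_def inner_commute real_div_sqrt)
      hence "N *v x = 0" using q by (simp add: Nv u_def)
      moreover have "N *v y = 0" if "M *v y = 0" for y
        using uy[of y] that by (simp add: Nv)
      \<comment> \<open>The vector \<open>x\<close> makes the inclusion strict, so the kernel gains
        a dimension and \<open>d\<close> squares suffice for \<open>N\<close>.\<close>
      ultimately have "{x. M *v x = 0} \<subset> {x. N *v x = 0}" using x by blast
      hence "dim {x. M *v x = 0} < dim {x. N *v x = 0}"
        by (intro dim_psubset) (simp only: span_eq_iff[THEN iffD2, OF sub(1)] span_eq_iff[THEN iffD2, OF sub(2)])
      with Suc.prems show ?thesis by simp
    qed
    ultimately obtain v where v: "N = (\<Sum>j<d. outer_square (v j))"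
      using Suc.IH by blast
    have "M = (\<Sum>j<Suc d. outer_square ((v(d := u)) j))"
      using v by (simp add: N_def algebra_simps)
    thus ?thesis by blast
  qed
qed

text \<open>The columns of \<open>R\<close> are the vectors of the decomposition; the rank bound is
  trivial at \<open>CARD('n)\<close>. This \<open>R\<close> acts as a square root of
  \<open>M\<close> in the trace estimates.\<close>

lemma psd_factorization:
  fixes M :: "real^'n^'n"
  assumes "psd_matrix M"
  shows "\<exists>R :: real^'n^'n. M = R ** transpose R"
proof -
  obtain v :: "nat \<Rightarrow> real^'n" where v: "M = (\<Sum>j<CARD('n). outer_square (v j))"
    using psd_sum_outer_squares[OF assms, of "CARD('n)"] by auto
  obtain h where h: "bij_betw h (UNIV :: 'n set) {..<CARD('n)}"
    using ex_bij_betw_finite_nat[of "UNIV :: 'n set"] by (auto simp: atLeast0LessThan)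
  have "M = (\<Sum>l\<in>UNIV. outer_square (v (h l)))"
    unfolding v by (rule sum.reindex_bij_betw[OF h, symmetric])
  also have "\<dots> = (\<chi> i l. v (h l) $ i) ** transpose (\<chi> i l. v (h l) $ i)"
    by (simp add: vec_eq_iff outer_square_def matrix_matrix_mult_def transpose_def)
  finally show ?thesis by blast
qed

section \<open>Trace inequalities for semidefinite matrices\<close>

lemma psd_trace_nonneg: "psd_matrix M \<Longrightarrow> 0 \<le> trace M"
  for M :: "real^'n^'n"
proof -
  assume "psd_matrix M"
  then obtain R :: "real^'n^'n" where R: "M = R ** transpose R" using psd_factorization by blast
  show ?thesis
    unfolding R trace_def matrix_matrix_mult_def transpose_def by (auto intro!: sum_nonneg)
qed

text \<open>By cyclicity this is the trace of the congruence \<open>transpose R ** N ** R\<close>,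
  where \<open>M = R ** transpose R\<close>.\<close>

lemma trace_mult_nonneg:
  fixes M N :: "real^'n^'n"
  assumes "psd_matrix M" and "psd_matrix N"
  shows "0 \<le> trace (M ** N)"
proof -
  obtain R :: "real^'n^'n" where R: "M = R ** transpose R" using psd_factorization[OF assms(1)] by blast
  have "trace (M ** N) = trace (transpose R ** N ** transpose (transpose R))"
    unfolding R using trace_mul_sym[of R "transpose R ** N"] by (simp add: matrix_mul_assoc)
  thus ?thesis using psd_trace_nonneg[OF psd_congruence[OF assms(2)]] by (simp only:)
qed

text \<open>The form at \<open>x\<close> sums the squared inner products of \<open>x\<close> with
  the columns of \<open>R\<close>, and the trace sums the squared norms of these columns;
  Cauchy-Schwarz compares them column by column.\<close>

lemma psd_le_trace:
  fixes M :: "real^'n^'n"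
  assumes "psd_matrix M"
  shows "psd_matrix (trace M *\<^sub>R mat 1 - M)"
proof (rule psd_matrixI)
  show "transpose (trace M *\<^sub>R mat 1 - M) = trace M *\<^sub>R mat 1 - M"
    by (simp add: transpose_distribs psd_transpose[OF assms])
  fix x
  obtain R :: "real^'n^'n" where R: "M = R ** transpose R" using psd_factorization[OF assms] by blast
  have "trace M = (\<Sum>l\<in>UNIV. \<Sum>i\<in>UNIV. (R $ i $ l)\<^sup>2)"
    unfolding R trace_def matrix_matrix_mult_def transpose_def
    by (subst sum.swap) (simp add: power2_eq_square)
  hence tr: "trace M = (\<Sum>l\<in>UNIV. column l R \<bullet> column l R)"
    by (simp add: inner_vec_def column_def power2_eq_square)
  have "x \<bullet> (M *v x) = (transpose R *v x) \<bullet> (transpose R *v x)"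
    unfolding R matrix_vector_mul_assoc[symmetric] by (rule inner_matrix_vector)
  also have "\<dots> = (\<Sum>l\<in>UNIV. (column l R \<bullet> x)\<^sup>2)"
    by (simp add: inner_vec_def[of "_ v* R"] vector_matrix_mult_def column_def inner_vec_def
        power2_eq_square mult_ac)
  also have "\<dots> \<le> (\<Sum>l\<in>UNIV. (column l R \<bullet> column l R) * (x \<bullet> x))"
    by (intro sum_mono Cauchy_Schwarz_ineq)
  also have "\<dots> = trace M * (x \<bullet> x)" by (simp add: tr sum_distrib_right)
  finally show "0 \<le> x \<bullet> ((trace M *\<^sub>R mat 1 - M) *v x)"
    by (simp add: matrix_vector_mult_diff_rdistrib scaleR_matrix_vector_assoc[symmetric]
        inner_diff_right)
qed

lemma trace_mult_le:
  assumes "psd_matrix M" and "psd_matrix N"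
  shows "trace (M ** N) \<le> trace M * trace N"
  using trace_mult_nonneg[OF assms(1) psd_le_trace[OF assms(2)]]
  by (simp add: mat_distribs trace_linear mult.commute)

text \<open>Splitting \<open>E = R ** transpose R\<close> and cycling turns the left side into the
  trace of a product of two congruences, whose own traces are the factors on the right.\<close>

lemma trace_mult4_le:
  fixes H E V :: "real^'n^'n"
  assumes "psd_matrix H" and "psd_matrix E" and "psd_matrix V"
  shows "trace (H ** E ** V ** E) \<le> trace (H ** E) * trace (V ** E)"
proof -
  obtain R :: "real^'n^'n" where R: "E = R ** transpose R" using psd_factorization[OF assms(2)] by blast
  let ?H = "transpose R ** H ** transpose (transpose R)"
  let ?V = "transpose R ** V ** transpose (transpose R)"
  have tr: "trace (M ** E) = trace (transpose R ** M ** transpose (transpose R))" for M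
    unfolding R using trace_mul_sym[of "M ** R" "transpose R"] by (simp add: matrix_mul_assoc)
  have "trace (H ** E ** V ** E) = trace (?H ** ?V)"
    unfolding R using trace_mul_sym[of "H ** R ** transpose R ** V ** R" "transpose R"]
    by (simp add: matrix_mul_assoc)
  also have "\<dots> \<le> trace ?H * trace ?V"
    by (intro trace_mult_le psd_congruence assms)
  finally show ?thesis by (simp add: tr)
qed

lemma psd_trace_zero:
  assumes "psd_matrix M" and "trace M = 0"
  shows "M = 0"
proof -
  have "M *v x = 0" for x
  proof -
    have "0 \<le> x \<bullet> ((trace M *\<^sub>R mat 1 - M) *v x)"
      by (rule psd_nonneg[OF psd_le_trace[OF assms(1)]])
    hence "x \<bullet> (M *v x) = 0"
      using assms(2) psd_nonneg[OF assms(1), of x]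
      by (simp add: matrix_vector_mult_diff_rdistrib[of 0 M, simplified])
    thus ?thesis by (rule psd_kernel[OF assms(1)])
  qed
  thus ?thesis by (simp add: matrix_eq)
qed

section \<open>Operator inequalities for products and resolvents\<close>

text \<open>Square roots are avoided by the identity
  \<open>c M (c - M) = (c - M) M (c - M) + M (c - M) M\<close>.\<close>

lemma psd_mult_diff:
  fixes M :: "real^'n^'n"
  assumes M: "psd_matrix M" and cM: "psd_matrix (c *\<^sub>R mat 1 - M)" and c: "0 < c"
  shows "psd_matrix (c *\<^sub>R M - M ** M)"
proof -
  let ?K = "c *\<^sub>R mat 1 - M"
  have "psd_matrix ((1 / c) *\<^sub>R (?K ** M ** ?K + M ** ?K ** M))"
    using M cM c psd_transpose[OF M] psd_transpose[OF cM]
    by (intro psd_scaleR psd_add psd_conj_symmetric) auto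
  also have "?K ** M ** ?K + M ** ?K ** M = c *\<^sub>R (c *\<^sub>R M - M ** M)"
    by (simp add: mat_distribs algebra_simps)
  finally show ?thesis using c by simp
qed

lemma psd_mult_diff_one:
  fixes M :: "real^'n^'n"
  assumes "psd_matrix M" and "psd_matrix (mat 1 - M)"
  shows "psd_matrix (M - M ** M)"
  using psd_mult_diff[of M 1] assms by simp

lemma psd_mult_diff_trace:
  assumes M: "psd_matrix M"
  shows "psd_matrix (trace M *\<^sub>R M - M ** M)"
proof (cases "trace M = 0")
  \<comment> \<open>\<open>psd_mult_diff\<close> asks for a positive constant; at trace zero,
    \<open>M\<close> itself vanishes.\<close>
  case True
  thus ?thesis using psd_trace_zero[OF M] by simp
next
  case False
  thus ?thesis using psd_trace_nonneg[OF M] psd_mult_diff[OF M psd_le_trace[OF M]] by simp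
qed

text \<open>The matrix equals \<open>(V - V ** V) + (F - F ** F) + (V - F) ** (V - F)\<close>, and
  each term is semidefinite because \<open>V\<close> and \<open>F\<close> lie between 0 and
  1.\<close>

lemma psd_anticommutator_bound:
  fixes V F :: "real^'n^'n"
  assumes F: "psd_matrix F" and VF: "psd_matrix (V - F)" and V1: "psd_matrix (mat 1 - V)"
  shows "psd_matrix (V + F - V ** F - F ** V)"
proof -
  have V: "psd_matrix V" using psd_add[OF F VF] by simp
  have F1: "psd_matrix (mat 1 - F)" using psd_add[OF V1 VF] by simp
  have "psd_matrix ((V - V ** V) + (F - F ** F) + (V - F) ** mat 1 ** (V - F))"
    using psd_mult_diff_one[OF V V1] psd_mult_diff_one[OF F F1] psd_transpose[OF VF]
    by (intro psd_add psd_conj_symmetric) auto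
  moreover have "(V - V ** V) + (F - F ** F) + (V - F) ** mat 1 ** (V - F)
      = V + F - V ** F - F ** V"
    by (simp add: mat_distribs)
  ultimately show ?thesis by (simp only:)
qed

text \<open>Since \<open>(1 - M)\<^sup>-\<^sup>1 = 1 + E\<close>, the last conclusion is the operator inequality
  \<open>(1 - M)\<^sup>-\<^sup>1 \<le> 1 + M / (1 - trace M)\<close>, an equality when \<open>M\<close> has rank one.\<close>

lemma resolvent_bound:
  fixes M :: "real^'n^'n"
  assumes M: "psd_matrix M" and tr: "trace M < 1"
  obtains E where "(mat 1 - M) ** (mat 1 + E) = mat 1" and "psd_matrix E"
    and "psd_matrix (M - (1 - trace M) *\<^sub>R E)"
proof -
  define c where "c = trace M"
  let ?N = "mat 1 - M"
  have c: "0 \<le> c" "c < 1" using psd_trace_nonneg[OF M] tr by (auto simp: c_def)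
  have cM: "psd_matrix (c *\<^sub>R mat 1 - M)" unfolding c_def by (rule psd_le_trace[OF M])
  \<comment> \<open>As \<open>M\<close> is at most \<open>c\<close> times the identity and
    \<open>c < 1\<close>, a fixed vector of \<open>M\<close> must vanish.\<close>
  have "?N *v x = 0 \<Longrightarrow> x = 0" for x
  proof -
    assume "?N *v x = 0"
    hence "M *v x = x" by (simp add: matrix_vector_mult_diff_rdistrib)
    hence "x \<bullet> x \<le> c * (x \<bullet> x)"
      using psd_nonneg[OF cM, of x]
      by (simp add: matrix_vector_mult_diff_rdistrib scaleR_matrix_vector_assoc[symmetric]
          inner_diff_right)
    hence "(1 - c) * (x \<bullet> x) \<le> 0" by (simp add: algebra_simps)
    hence "x \<bullet> x \<le> 0" using c by (simp add: mult_le_0_iff)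
    thus "x = 0" by (metis inner_eq_zero_iff inner_ge_zero order.antisym)
  qed
  then obtain D where DN: "D ** ?N = mat 1"
    using matrix_left_invertible_ker[of ?N] by blast
  hence ND: "?N ** D = mat 1" by (simp add: matrix_left_right_inverse)
  have symM: "transpose M = M" by (rule psd_transpose[OF M])
  have "?N ** transpose D = mat 1"
    using arg_cong[OF DN, of transpose] by (simp add: transpose_distribs symM)
  hence "D ** (?N ** transpose D) = D" by simp
  hence symD: "transpose D = D" by (simp add: matrix_mul_assoc DN)
  have MD: "M ** D = D - mat 1" using ND by (simp add: mat_distribs algebra_simps)
  have DM: "D ** M = D - mat 1" using DN by (simp add: mat_distribs algebra_simps)
  define E where "E = D - mat 1"
  \<comment> \<open>This form shows that \<open>E\<close> is semidefinite once \<open>D\<close>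
    is.\<close>
  have E_alt: "E = M + M ** D ** M"
    by (simp add: E_def mat_distribs DM MD)
  have D_psd: "psd_matrix D"
  proof -
    have "psd_matrix ?N"
      using psd_add[OF cM psd_scaleR[OF psd_one, of "1 - c"]] c by (simp add: algebra_simps)
    hence "psd_matrix (D ** ?N ** D)" using symD by (intro psd_conj_symmetric) auto
    thus ?thesis by (simp add: DN)
  qed
  have 1: "?N ** (mat 1 + E) = mat 1" by (simp add: E_def ND)
  have 2: "psd_matrix E"
    unfolding E_alt using M D_psd symM by (intro psd_add psd_conj_symmetric) auto
  have 3: "M - (1 - c) *\<^sub>R E = E ** (c *\<^sub>R mat 1 - M)"
    by (simp add: E_def mat_distribs DM algebra_simps)
  have P: "psd_matrix (c *\<^sub>R M - M ** M)"
    unfolding c_def by (rule psd_mult_diff_trace[OF M])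
  let ?K = "c *\<^sub>R mat 1 - M"
  \<comment> \<open>The product in fact \<open>3\<close> is not visibly semidefinite. Writing
    \<open>?N\<close> as \<open>(1 - c) *\<^sub>R mat 1 + ?K\<close> splits
    \<open>M ** ?K ** ?N\<close> into two semidefinite terms, and conjugation by \<open>D\<close>
    turns that matrix into \<open>E ** ?K\<close>.\<close>
  have "psd_matrix (D ** ((1 - c) *\<^sub>R (c *\<^sub>R M - M ** M) + ?K ** M ** ?K) ** D)"
    using c symD psd_transpose[OF cM]
    by (intro psd_conj_symmetric psd_add psd_scaleR P M) auto
  also have "(1 - c) *\<^sub>R (c *\<^sub>R M - M ** M) + ?K ** M ** ?K = M ** ?K ** ?N"
    by (simp add: mat_distribs algebra_simps)
  also have "D ** (M ** ?K ** ?N) ** D = (D ** M) ** ?K ** (?N ** D)"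
    by (simp only: matrix_mul_assoc)
  also have "\<dots> = E ** ?K" by (simp only: DM ND E_def matrix_mul_rid)
  finally have "psd_matrix (M - (1 - c) *\<^sub>R E)" by (simp only: 3)
  with 1 2 show thesis by (intro that[of E]) (simp_all only: c_def)
qed

text \<open>This trades the terms quadratic in \<open>E\<close> for the slack of the resolvent
  bound. Two uses of \<open>trace_mult4_le\<close> give it: with
  \<open>trace M *\<^sub>R mat 1 - M\<close> for the case \<open>B = mat 1\<close>, then with
  \<open>mat 1 - B\<close> for general \<open>B\<close>. Both sides vanish when \<open>M\<close> has
  rank one.\<close>

lemma trace_resolvent_quadratic_bound:
  fixes B H M E :: "real^'n^'n"
  assumes B: "psd_matrix B" "psd_matrix (mat 1 - B)" and H: "psd_matrix H"
    and M: "psd_matrix M" and tr: "trace M < 1"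
    and E: "(mat 1 - M) ** (mat 1 + E) = mat 1" "psd_matrix E"
  shows "(1 - trace M) * (trace (H ** E) * trace (B ** E) - trace (H ** E ** B ** E))
    \<le> trace (H ** (M - (1 - trace M) *\<^sub>R E))"
proof -
  define w where "w = 1 - trace M"
  have w: "0 < w" using tr by (simp add: w_def)
  let ?K = "trace M *\<^sub>R mat 1 - M"
  have E': "(mat 1 + E) ** (mat 1 - M) = mat 1"
    using E(1) by (simp add: matrix_left_right_inverse)
  have ME: "M ** E = E - M" using E(1) by (simp add: mat_distribs algebra_simps)
  have EM: "E ** M = E - M" using E' by (simp add: mat_distribs algebra_simps)
  have "trace (H ** E ** ?K ** E) \<le> trace (H ** E) * trace (?K ** E)"
    by (intro trace_mult4_le H E psd_le_trace M)
  moreover have "trace (H ** E ** ?K ** E) = trace (H ** E) - trace (H ** M) - w * trace (H ** E ** E)"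
    by (simp add: mat_distribs trace_linear ME EM w_def algebra_simps)
  moreover have "trace (?K ** E) = 1 - w - w * trace E"
    by (simp add: mat_distribs trace_linear ME w_def algebra_simps)
  ultimately have 1: "w * (trace (H ** E) * trace E - trace (H ** E ** E))
      \<le> trace (H ** M) - w * trace (H ** E)"
    by (simp add: algebra_simps)
  have "trace (H ** E ** (mat 1 - B) ** E) \<le> trace (H ** E) * trace ((mat 1 - B) ** E)"
    by (intro trace_mult4_le H E B)
  hence "trace (H ** E) * trace (B ** E) - trace (H ** E ** B ** E)
      \<le> trace (H ** E) * trace E - trace (H ** E ** E)"
    by (simp add: mat_distribs trace_linear algebra_simps)
  hence "w * (trace (H ** E) * trace (B ** E) - trace (H ** E ** B ** E))
      \<le> w * (trace (H ** E) * trace E - trace (H ** E ** E))"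
    using w by (intro mult_left_mono) auto
  with 1 show ?thesis by (simp add: mat_distribs trace_linear w_def)
qed

subsection \<open>Deleting one index\<close>

text \<open>The normalized case \<open>A = mat 1\<close>. The inequality compares the potentials
  before and after the deletion, multiplied by the new value
  \<open>\<kappa> + trace (B ** E)\<close> of \<open>\<kappa>\<close>, which avoids dividing by a
  quantity that depends on \<open>E\<close>.\<close>

lemma removal_step_identity:
  fixes B H :: "real^'n^'n" and Bs :: "'i \<Rightarrow> real^'n^'n" and r :: nat and \<kappa> :: real
  assumes fin: "finite \<sigma>" and B: "psd_matrix B" and H: "psd_matrix H"
    and Bs: "\<And>i. i \<in> \<sigma> \<Longrightarrow> psd_matrix (Bs i)"
    and sum1: "B + (\<Sum>i\<in>\<sigma>. Bs i) = mat 1"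
    and r: "1 \<le> r"
    and \<kappa>: "\<kappa> = real (card \<sigma>) - real r - real CARD('n) + 1 + trace B" "1 \<le> \<kappa>"
  shows "\<exists>i\<in>\<sigma>. \<exists>E. (mat 1 - Bs i) ** (mat 1 + E) = mat 1 \<and> psd_matrix E \<and>
    trace (H ** E) * (\<kappa> + trace (B ** E))
      + (real r - 1) * (trace (H ** (mat 1 + E)) - trace (H ** (mat 1 + E) ** B ** (mat 1 + E)))
    \<le> real r * (trace H - trace (H ** B)) / \<kappa> * (\<kappa> + trace (B ** E))"
proof (rule ccontr)
  assume contra: "\<not> ?thesis"
  define V where "V = mat 1 - B"
  have V_sum: "V = (\<Sum>i\<in>\<sigma>. Bs i)" using sum1 by (simp add: V_def algebra_simps)
  have V: "psd_matrix V" unfolding V_sum by (rule psd_sum[OF Bs])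
  have B1: "psd_matrix (mat 1 - B)" using V by (simp add: V_def)
  have V1: "psd_matrix (mat 1 - V)" using B by (simp add: V_def)
  define w where "w i = 1 - trace (Bs i)" for i
  define P where "P = {i \<in> \<sigma>. 0 < w i}"
  have P: "finite P" "P \<subseteq> \<sigma>" using fin by (auto simp: P_def)
  have "\<forall>i\<in>P. \<exists>E. (mat 1 - Bs i) ** (mat 1 + E) = mat 1 \<and> psd_matrix E \<and> psd_matrix (Bs i - w i *\<^sub>R E)"
  proof
    fix i assume "i \<in> P"
    hence "psd_matrix (Bs i)" "trace (Bs i) < 1" using Bs by (auto simp: P_def w_def)
    from resolvent_bound[OF this]
    show "\<exists>E. (mat 1 - Bs i) ** (mat 1 + E) = mat 1 \<and> psd_matrix E \<and> psd_matrix (Bs i - w i *\<^sub>R E)"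
      unfolding w_def by metis
  qed
  then obtain E where E: "\<And>i. i \<in> P \<Longrightarrow> (mat 1 - Bs i) ** (mat 1 + E i) = mat 1"
      "\<And>i. i \<in> P \<Longrightarrow> psd_matrix (E i)" "\<And>i. i \<in> P \<Longrightarrow> psd_matrix (Bs i - w i *\<^sub>R E i)"
    by metis
  \<comment> \<open>\<open>X\<close> is the sum of all the weights \<open>w i\<close>, obtained by
    taking traces in \<open>sum1\<close>. It bounds the sum over \<open>P\<close> from below, since
    the weights left out are nonpositive.\<close>
  define X where "X = \<kappa> + real r - 1"
  define F where "F = (\<Sum>i\<in>P. w i *\<^sub>R E i)"
  define h where "h = trace (H ** V)"
  have h: "h = trace H - trace (H ** B)" "0 \<le> h"
    unfolding h_def using trace_mult_nonneg[OF H V] by (simp_all add: V_def mat_distribs trace_linear)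
  have F: "psd_matrix F"
    unfolding F_def by (intro psd_sum psd_scaleR E) (auto simp: P_def)
  have slack: "V - F = (\<Sum>i\<in>P. Bs i - w i *\<^sub>R E i) + (\<Sum>i\<in>\<sigma> - P. Bs i)"
    unfolding V_sum F_def sum_subtractf sum.subset_diff[OF P(2) fin] by simp
  have rest: "psd_matrix (\<Sum>i\<in>\<sigma> - P. Bs i)" by (intro psd_sum Bs) auto
  have VF: "psd_matrix (V - F)"
    unfolding slack by (intro psd_add rest psd_sum E)
  have wX: "X \<le> (\<Sum>i\<in>P. w i)"
  proof -
    have "trace V = (\<Sum>i\<in>\<sigma>. trace (Bs i))" unfolding V_sum by (rule trace_sum)
    moreover have "trace V = real CARD('n) - trace B" by (simp add: V_def trace_linear trace_I)
    ultimately have "X = (\<Sum>i\<in>\<sigma>. w i)"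
      by (simp add: X_def \<kappa>(1) w_def sum_subtractf)
    also have "\<dots> = (\<Sum>i\<in>\<sigma> - P. w i) + (\<Sum>i\<in>P. w i)" by (rule sum.subset_diff[OF P(2) fin])
    also have "(\<Sum>i\<in>\<sigma> - P. w i) \<le> 0" by (rule sum_nonpos) (auto simp: P_def)
    finally show ?thesis by simp
  qed
  have X: "real r \<le> X" "1 \<le> X" using \<kappa>(2) r by (auto simp: X_def)
  have "P \<noteq> {}" using wX X by auto
  have wpos: "0 < w i" if "i \<in> P" for i using that by (simp add: P_def)
  have BE: "0 \<le> trace (B ** E i)" if "i \<in> P" for i by (intro trace_mult_nonneg B E that)
  have no: "trace (H ** E i) * (\<kappa> + trace (B ** E i))
      + (real r - 1) * (trace (H ** (mat 1 + E i)) - trace (H ** (mat 1 + E i) ** B ** (mat 1 + E i)))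
      > real r * h / \<kappa> * (\<kappa> + trace (B ** E i))" if "i \<in> P" for i
  proof (rule ccontr)
    assume "\<not> ?thesis"
    with that P(2) E(1,2)[OF that] have "\<exists>i\<in>\<sigma>. \<exists>E. (mat 1 - Bs i) ** (mat 1 + E) = mat 1 \<and> psd_matrix E \<and>
      trace (H ** E) * (\<kappa> + trace (B ** E))
        + (real r - 1) * (trace (H ** (mat 1 + E)) - trace (H ** (mat 1 + E) ** B ** (mat 1 + E)))
      \<le> real r * h / \<kappa> * (\<kappa> + trace (B ** E))"
      by (intro bexI[of _ i] exI[of _ "E i"] conjI) (auto simp only: not_less)
    with contra show False unfolding h(1) by blast
  qed
  show False
  proof (cases "r = 1")
    \<comment> \<open>The other case needs \<open>r \<ge> 2\<close> to lower the coefficient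
      \<open>r - 1\<close> of a quadratic term to 1. Here the second part of the new potential
      disappears and \<open>X = \<kappa>\<close>.\<close>
    case True
    have "X * (h / \<kappa>) \<le> (\<Sum>i\<in>P. w i) * (h / \<kappa>)"
      using wX h(2) \<kappa>(2) by (intro mult_right_mono) auto
    also have "\<dots> = (\<Sum>i\<in>P. w i * (h / \<kappa>))" by (rule sum_distrib_right)
    also have "\<dots> < (\<Sum>i\<in>P. w i * trace (H ** E i))"
    proof (rule sum_strict_mono[OF P(1) \<open>P \<noteq> {}\<close>])
      fix i assume i: "i \<in> P"
      have "h / \<kappa> * (\<kappa> + trace (B ** E i)) < trace (H ** E i) * (\<kappa> + trace (B ** E i))"
        using no[OF i] True by simp
      hence "h / \<kappa> < trace (H ** E i)"
        using BE[OF i] \<kappa>(2) by (simp only: mult_less_cancel_right)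
      thus "w i * (h / \<kappa>) < w i * trace (H ** E i)"
        by (rule mult_strict_left_mono[OF _ wpos[OF i]])
    qed
    also have "\<dots> = trace (H ** F)"
      by (simp add: F_def matrix_sum_ldistrib mat_distribs trace_sum trace_linear)
    also have "\<dots> \<le> h"
      using trace_mult_nonneg[OF H VF] by (simp add: h_def mat_distribs trace_linear)
    finally show False using \<kappa>(2) True by (simp add: X_def)
  next
    case False
    hence r2: "2 \<le> real r" using r by simp
    \<comment> \<open>\<open>?G i\<close> bounds the increment after dropping the nonnegative term
      with \<open>trace (B ** E i)\<close> on the right of \<open>no\<close> and lowering the
      coefficient of \<open>trace (H ** E i ** B ** E i)\<close> to 1, the form that
      \<open>trace_resolvent_quadratic_bound\<close> controls.\<close>
    let ?G = "\<lambda>i. X * trace (H ** E i) - h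
      - (real r - 1) * (trace (H ** E i ** B) + trace (H ** B ** E i))
      + (trace (H ** E i) * trace (B ** E i) - trace (H ** E i ** B ** E i))"
    have G: "0 < ?G i" if i: "i \<in> P" for i
    proof -
      have "psd_matrix (E i ** B ** E i)"
        by (rule psd_conj_symmetric[OF B psd_transpose[OF E(2)[OF i]]])
      hence "0 \<le> trace (H ** E i ** B ** E i)"
        using trace_mult_nonneg[OF H, of "E i ** B ** E i"] by (simp add: matrix_mul_assoc)
      hence 1: "0 \<le> (real r - 2) * trace (H ** E i ** B ** E i)" using r2 by simp
      have "0 \<le> real r * h / \<kappa> * trace (B ** E i)"
        using h(2) \<kappa>(2) BE[OF i] by simp
      moreover have "real r * h / \<kappa> * (\<kappa> + trace (B ** E i)) = real r * h + real r * h / \<kappa> * trace (B ** E i)"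
        using \<kappa>(2) by (simp add: field_simps)
      ultimately have 2: "real r * h < trace (H ** E i) * (\<kappa> + trace (B ** E i))
      + (real r - 1) * (trace (H ** (mat 1 + E i)) - trace (H ** (mat 1 + E i) ** B ** (mat 1 + E i)))"
        using no[OF i] by linarith
      have 3: "trace (H ** (mat 1 + E i)) - trace (H ** (mat 1 + E i) ** B ** (mat 1 + E i))
        = h + trace (H ** E i) - trace (H ** E i ** B) - trace (H ** B ** E i) - trace (H ** E i ** B ** E i)"
        by (simp add: h(1) mat_distribs trace_linear)
      show ?thesis using 1 2 unfolding 3 by (simp add: X_def algebra_simps)
    qed
    have quad: "w i * (trace (H ** E i) * trace (B ** E i) - trace (H ** E i ** B ** E i))
        \<le> trace (H ** (Bs i - w i *\<^sub>R E i))" if i: "i \<in> P" for i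
      unfolding w_def using i P(2) wpos[OF i] w_def
      by (intro trace_resolvent_quadratic_bound[OF B B1 H] Bs E[OF i]) auto
    have "0 < (\<Sum>i\<in>P. w i * ?G i)"
      using wpos G by (intro sum_pos P(1) \<open>P \<noteq> {}\<close> mult_pos_pos)
    also have "\<dots> \<le> (\<Sum>i\<in>P. X * trace (H ** (w i *\<^sub>R E i)) - h * w i
        - (real r - 1) * (trace (H ** (w i *\<^sub>R E i) ** B) + trace (H ** B ** (w i *\<^sub>R E i)))
        + trace (H ** (Bs i - w i *\<^sub>R E i)))"
    proof (rule sum_mono)
      fix i assume "i \<in> P"
      from quad[OF this] show "w i * ?G i \<le> X * trace (H ** (w i *\<^sub>R E i)) - h * w i
        - (real r - 1) * (trace (H ** (w i *\<^sub>R E i) ** B) + trace (H ** B ** (w i *\<^sub>R E i)))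
        + trace (H ** (Bs i - w i *\<^sub>R E i))"
        by (simp add: mat_distribs trace_linear algebra_simps)
    qed
    also have "\<dots> = X * trace (H ** F) - h * (\<Sum>i\<in>P. w i)
        - (real r - 1) * (trace (H ** F ** B) + trace (H ** B ** F))
        + trace (H ** (\<Sum>i\<in>P. Bs i - w i *\<^sub>R E i))"
      unfolding F_def
      by (simp only: matrix_sum_ldistrib matrix_sum_rdistrib trace_sum sum.distrib sum_subtractf
          sum_distrib_left distrib_left matrix_diff_ldistrib trace_sub)
    also have "\<dots> \<le> X * trace (H ** F) - h * X
        - (real r - 1) * (trace (H ** F ** B) + trace (H ** B ** F)) + trace (H ** (V - F))"
    proof -
      have "trace (H ** (\<Sum>i\<in>P. Bs i - w i *\<^sub>R E i)) \<le> trace (H ** (V - F))"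
        unfolding slack using trace_mult_nonneg[OF H rest] by (simp add: matrix_add_ldistrib trace_add)
      moreover have "h * X \<le> h * (\<Sum>i\<in>P. w i)" using wX h(2) by (intro mult_left_mono)
      ultimately show ?thesis by linarith
    qed
    \<comment> \<open>Substituting \<open>B = mat 1 - V\<close> leaves two semidefinite matrices
      traced against \<open>H\<close>; the coefficients \<open>X - real r = \<kappa> - 1\<close> and
      \<open>real r - 1\<close> are nonnegative.\<close>
    also have "\<dots> = - (X - real r) * trace (H ** (V - F)) - (real r - 1) * trace (H ** (V + F - V ** F - F ** V))"
      by (simp add: h_def V_def mat_distribs trace_linear algebra_simps)
    also have "\<dots> \<le> 0"
    proof -
      have "0 \<le> (X - real r) * trace (H ** (V - F))"
        using X trace_mult_nonneg[OF H VF] by simp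
      moreover have "0 \<le> (real r - 1) * trace (H ** (V + F - V ** F - F ** V))"
        using r2 trace_mult_nonneg[OF H psd_anticommutator_bound[OF F VF V1]] by simp
      ultimately show ?thesis by linarith
    qed
    finally show False by simp
  qed
qed

section \<open>General \<open>A\<close>: undoing the congruence and iterating the deletion\<close>

lemma matrix_inv_unique_right:
  fixes A D :: "real^'n^'n"
  assumes "A ** D = mat 1"
  shows "invertible A" and "matrix_inv A = D"
proof -
  have DA: "D ** A = mat 1" using assms by (simp add: matrix_left_right_inverse)
  show inv: "invertible A" using assms DA by (auto simp: invertible_def)
  have "A ** matrix_inv A = mat 1 \<and> matrix_inv A ** A = mat 1"
    unfolding matrix_inv_def using inv unfolding invertible_def by (rule someI_ex)
  hence left: "matrix_inv A ** A = mat 1" ..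
  have "matrix_inv A = matrix_inv A ** (A ** D)" using assms by simp
  also have "\<dots> = matrix_inv A ** A ** D" by (simp only: matrix_mul_assoc)
  also have "\<dots> = D" using left by simp
  finally show "matrix_inv A = D" .
qed

text \<open>Congruence by the inverse \<open>Q\<close> of a factor \<open>R\<close> of
  \<open>A\<close> reduces to the identity. Traces are then taken against
  \<open>H = Q ** transpose Q\<close>, and \<open>\<kappa>\<close> keeps its value. The conclusion
  \<open>\<kappa> \<le> \<kappa>'\<close> preserves the lower bound 1 for the next deletion.\<close>

lemma removal_step:
  fixes A B :: "real^'n^'n" and Bs :: "'i \<Rightarrow> real^'n^'n" and r :: nat and \<kappa> :: real
  assumes fin: "finite \<sigma>" and B: "psd_matrix B"
    and Bs: "\<And>i. i \<in> \<sigma> \<Longrightarrow> psd_matrix (Bs i)"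
    and A: "A = B + (\<Sum>i\<in>\<sigma>. Bs i)" "invertible A"
    and r: "1 \<le> r"
    and \<kappa>: "\<kappa> = real (card \<sigma>) - real r - real CARD('n) + 1 + trace (matrix_inv A ** B)" "1 \<le> \<kappa>"
  shows "\<exists>i\<in>\<sigma>. \<exists>D \<kappa>'. (A - Bs i) ** D = mat 1 \<and>
    \<kappa>' = \<kappa> + (trace (D ** B) - trace (matrix_inv A ** B)) \<and> \<kappa> \<le> \<kappa>' \<and>
    trace D + (real r - 1) * (trace D - trace (D ** D ** B)) / \<kappa>'
      \<le> trace (matrix_inv A)
        + real r * (trace (matrix_inv A) - trace (matrix_inv A ** matrix_inv A ** B)) / \<kappa>"
proof -
  have psdA: "psd_matrix A" unfolding A(1) by (intro psd_add B psd_sum Bs)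
  obtain R :: "real^'n^'n" where R: "A = R ** transpose R"
    using psd_factorization[OF psdA] by blast
  obtain A' where "A ** A' = mat 1" using A(2) by (auto simp: invertible_def)
  hence "R ** (transpose R ** A') = mat 1" unfolding R by (simp add: matrix_mul_assoc)
  then obtain Q where RQ: "R ** Q = mat 1" by blast
  hence QR: "Q ** R = mat 1" by (simp add: matrix_left_right_inverse)
  define Q' where "Q' = transpose Q"
  define R' where "R' = transpose R"
  have RQ': "R' ** Q' = mat 1" and QR': "Q' ** R' = mat 1"
    using arg_cong[OF QR, of transpose] arg_cong[OF RQ, of transpose]
    by (simp_all add: Q'_def R'_def matrix_transpose_mul)
  have cancel: "Q ** (R ** M) = M" "R ** (Q ** M) = M" "R' ** (Q' ** M) = M" "Q' ** (R' ** M) = M" for M :: "real^'n^'n"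
    by (simp_all add: matrix_mul_assoc RQ QR RQ' QR')
  have AR: "A = R ** R'" by (simp add: R R'_def)
  have invA: "matrix_inv A = Q' ** Q"
    by (rule matrix_inv_unique_right) (simp add: AR matrix_mul_assoc[symmetric] cancel RQ)
  define H where "H = Q ** Q'"
  define B' where "B' = Q ** B ** Q'"
  define Bs' where "Bs' i = Q ** Bs i ** Q'" for i
  have H: "psd_matrix H"
    using psd_congruence[OF psd_one, of Q] by (simp add: H_def Q'_def)
  have B': "psd_matrix B'" unfolding B'_def Q'_def by (rule psd_congruence[OF B])
  have Bs': "psd_matrix (Bs' i)" if "i \<in> \<sigma>" for i
    unfolding Bs'_def Q'_def by (rule psd_congruence[OF Bs[OF that]])
  have sum1: "B' + (\<Sum>i\<in>\<sigma>. Bs' i) = mat 1"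
  proof -
    have "B' + (\<Sum>i\<in>\<sigma>. Bs' i) = Q ** A ** Q'"
      by (simp add: A(1) B'_def Bs'_def mat_distribs matrix_sum_ldistrib matrix_sum_rdistrib)
    also have "\<dots> = mat 1" by (simp add: AR matrix_mul_assoc[symmetric] cancel RQ')
    finally show ?thesis .
  qed
  \<comment> \<open>Cyclicity is instantiated at a leading \<open>Q'\<close>, so that rewriting
    moves only this factor to the end.\<close>
  have cyc: "trace (Q' ** M) = trace (M ** Q')" for M :: "real^'n^'n" by (rule trace_mul_sym)
  have trA: "trace (matrix_inv A) = trace H" "trace (matrix_inv A ** B) = trace B'"
      "trace (matrix_inv A ** matrix_inv A ** B) = trace (H ** B')"
    by (simp_all add: invA H_def B'_def matrix_mul_assoc[symmetric] cyc)
  have \<kappa>': "\<kappa> = real (card \<sigma>) - real r - real CARD('n) + 1 + trace B'"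
    using \<kappa>(1) by (simp add: trA)
  have "\<exists>i\<in>\<sigma>. \<exists>E. (mat 1 - Bs' i) ** (mat 1 + E) = mat 1 \<and> psd_matrix E \<and>
    trace (H ** E) * (\<kappa> + trace (B' ** E))
      + (real r - 1) * (trace (H ** (mat 1 + E)) - trace (H ** (mat 1 + E) ** B' ** (mat 1 + E)))
    \<le> real r * (trace H - trace (H ** B')) / \<kappa> * (\<kappa> + trace (B' ** E))"
    by (rule removal_step_identity[OF fin B' H _ sum1 r \<kappa>' \<kappa>(2)]) (rule Bs')
  then obtain i E where i: "i \<in> \<sigma>" and E: "(mat 1 - Bs' i) ** (mat 1 + E) = mat 1" "psd_matrix E"
    and step: "trace (H ** E) * (\<kappa> + trace (B' ** E))
      + (real r - 1) * (trace (H ** (mat 1 + E)) - trace (H ** (mat 1 + E) ** B' ** (mat 1 + E)))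
    \<le> real r * (trace H - trace (H ** B')) / \<kappa> * (\<kappa> + trace (B' ** E))"
    by blast
  \<comment> \<open>The inverse of \<open>A - Bs i\<close>, carried back through the
    congruence.\<close>
  define D where "D = Q' ** (mat 1 + E) ** Q"
  have "(A - Bs i) ** D = R ** ((mat 1 - Bs' i) ** (mat 1 + E)) ** Q"
    by (simp add: AR D_def Bs'_def mat_distribs cancel)
  hence inv: "(A - Bs i) ** D = mat 1" by (simp add: E RQ)
  have trD: "trace D = trace (H ** (mat 1 + E))"
      "trace (D ** D ** B) = trace (H ** (mat 1 + E) ** B' ** (mat 1 + E))"
      "trace (D ** B) = trace B' + trace (B' ** E)"
  proof -
    have "trace D = trace ((mat 1 + E) ** H)"
      by (simp add: D_def H_def matrix_mul_assoc[symmetric] cyc)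
    also have "\<dots> = trace (H ** (mat 1 + E))" by (rule trace_mul_sym)
    finally show "trace D = trace (H ** (mat 1 + E))" .
    have "trace (D ** D ** B) = trace ((mat 1 + E) ** (H ** (mat 1 + E) ** B'))"
      by (simp add: D_def H_def B'_def matrix_mul_assoc[symmetric] cyc)
    also have "\<dots> = trace (H ** (mat 1 + E) ** B' ** (mat 1 + E))" by (rule trace_mul_sym)
    finally show "trace (D ** D ** B) = trace (H ** (mat 1 + E) ** B' ** (mat 1 + E))" .
    have "trace (D ** B) = trace ((mat 1 + E) ** B')"
      by (simp add: D_def B'_def matrix_mul_assoc[symmetric] cyc)
    also have "\<dots> = trace (B' ** (mat 1 + E))" by (rule trace_mul_sym)
    finally show "trace (D ** B) = trace B' + trace (B' ** E)"
      by (simp add: mat_distribs trace_linear)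
  qed
  define \<mu> where "\<mu> = \<kappa> + trace (B' ** E)"
  have \<mu>: "\<kappa> \<le> \<mu>" unfolding \<mu>_def using trace_mult_nonneg[OF B' E(2)] by simp
  have "(trace (H ** E) + (real r - 1) * (trace D - trace (D ** D ** B)) / \<mu>) * \<mu>
      \<le> real r * (trace H - trace (H ** B')) / \<kappa> * \<mu>"
    using step \<mu> \<kappa>(2) by (simp add: trD \<mu>_def[symmetric] distrib_right)
  hence "trace (H ** E) + (real r - 1) * (trace D - trace (D ** D ** B)) / \<mu>
      \<le> real r * (trace H - trace (H ** B')) / \<kappa>"
    using \<mu> \<kappa>(2) by (simp only: mult_le_cancel_right)
  moreover have "trace D = trace H + trace (H ** E)" by (simp add: trD mat_distribs trace_linear)
  moreover have "\<mu> = \<kappa> + (trace (D ** B) - trace (matrix_inv A ** B))"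
    by (simp add: trA(2) trD(3) \<mu>_def)
  ultimately show ?thesis
    using i inv \<mu> unfolding trA(1,3) by (intro bexI[of _ i] exI[of _ D] exI[of _ \<mu>]) auto
qed

text \<open>Each deletion keeps the right-hand side from growing, and at \<open>r = 0\<close> its
  second term is gone. \<open>\<kappa>\<close> contains the target size \<open>k\<close>, not the
  current size of \<open>\<sigma>\<close>, so a deletion changes it only through the trace.\<close>

lemma subset_selection:
  fixes B :: "real^'n^'n" and Bs :: "'i \<Rightarrow> real^'n^'n" and k r :: nat
  assumes fin: "finite \<sigma>" and B: "psd_matrix B"
    and Bs: "\<And>i. i \<in> \<sigma> \<Longrightarrow> psd_matrix (Bs i)"
    and A: "A = B + (\<Sum>i\<in>\<sigma>. Bs i)" "invertible A"
    and card: "card \<sigma> = k + r"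
    and \<kappa>: "\<kappa> = real k - real CARD('n) + 1 + trace (matrix_inv A ** B)" "1 \<le> \<kappa>"
  shows "\<exists>\<tau>\<subseteq>\<sigma>. card \<tau> = k \<and> invertible (B + (\<Sum>i\<in>\<tau>. Bs i)) \<and>
    trace (matrix_inv (B + (\<Sum>i\<in>\<tau>. Bs i)))
      \<le> trace (matrix_inv A)
        + real r * (trace (matrix_inv A) - trace (matrix_inv A ** matrix_inv A ** B)) / \<kappa>"
  using assms
proof (induction r arbitrary: \<sigma> A \<kappa>)
  case 0
  thus ?case by (intro exI[of _ \<sigma>]) auto
next
  case (Suc r)
  have \<kappa>: "\<kappa> = real (card \<sigma>) - real (Suc r) - real CARD('n) + 1 + trace (matrix_inv A ** B)"
    using Suc.prems by simp
  have "\<exists>i\<in>\<sigma>. \<exists>D \<kappa>'. (A - Bs i) ** D = mat 1 \<and>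
    \<kappa>' = \<kappa> + (trace (D ** B) - trace (matrix_inv A ** B)) \<and> \<kappa> \<le> \<kappa>' \<and>
    trace D + (real (Suc r) - 1) * (trace D - trace (D ** D ** B)) / \<kappa>'
      \<le> trace (matrix_inv A)
        + real (Suc r) * (trace (matrix_inv A) - trace (matrix_inv A ** matrix_inv A ** B)) / \<kappa>"
    by (rule removal_step[OF Suc.prems(1,2) _ Suc.prems(4,5) _ \<kappa> Suc.prems(8)])
      (simp_all add: Suc.prems(3))
  then obtain i D \<kappa>' where i: "i \<in> \<sigma>" and D: "(A - Bs i) ** D = mat 1"
    and \<kappa>': "\<kappa>' = \<kappa> + (trace (D ** B) - trace (matrix_inv A ** B))" "\<kappa> \<le> \<kappa>'"
    and step: "trace D + (real (Suc r) - 1) * (trace D - trace (D ** D ** B)) / \<kappa>'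
      \<le> trace (matrix_inv A)
        + real (Suc r) * (trace (matrix_inv A) - trace (matrix_inv A ** matrix_inv A ** B)) / \<kappa>"
    by blast
  have A': "A - Bs i = B + (\<Sum>i\<in>\<sigma> - {i}. Bs i)"
    using Suc.prems(1,4) i by (simp add: sum.remove)
  note inv = matrix_inv_unique_right[OF D]
  have "\<exists>\<tau>\<subseteq>\<sigma> - {i}. card \<tau> = k \<and> invertible (B + (\<Sum>i\<in>\<tau>. Bs i)) \<and>
    trace (matrix_inv (B + (\<Sum>i\<in>\<tau>. Bs i)))
      \<le> trace (matrix_inv (A - Bs i))
        + real r * (trace (matrix_inv (A - Bs i))
          - trace (matrix_inv (A - Bs i) ** matrix_inv (A - Bs i) ** B)) / \<kappa>'"
    using Suc.prems i \<kappa>' inv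
    by (intro Suc.IH[OF _ _ _ A' inv(1)]) auto
  then obtain \<tau> where "\<tau> \<subseteq> \<sigma> - {i}" "card \<tau> = k" "invertible (B + (\<Sum>i\<in>\<tau>. Bs i))"
    "trace (matrix_inv (B + (\<Sum>i\<in>\<tau>. Bs i))) \<le> trace D + real r * (trace D - trace (D ** D ** B)) / \<kappa>'"
    unfolding inv(2) by blast
  with step show ?case by (intro exI[of _ \<tau>]) auto
qed

text \<open>A subset of \<open>{1..m}\<close> of size \<open>k\<close> exists only if
  \<open>k \<le> m\<close>, hence the guards on the size in both parts.\<close>

theorem theorem1p2:
  fixes A B :: "real^'n^'n" and Bs :: "nat \<Rightarrow> real^'n^'n" and m :: nat
  assumes "psd_matrix A" and "psd_matrix B"
    and "\<And>i. i \<in> {1..m} \<Longrightarrow> psd_matrix (Bs i)"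
    and "A = B + (\<Sum>i\<in>{1..m}. Bs i)"
    and "rank A = CARD('n)"
  shows "(\<forall>k::nat. int k \<ge> int CARD('n) - \<lfloor>trace (matrix_inv A ** B)\<rfloor> \<and> k \<le> m \<longrightarrow>
           (\<exists>\<sigma>. \<sigma> \<subseteq> {1..m} \<and> card \<sigma> = k \<and>
              invertible (B + (\<Sum>i\<in>\<sigma>. Bs i)) \<and>
              trace (matrix_inv (B + (\<Sum>i\<in>\<sigma>. Bs i)))
                \<le> trace (matrix_inv A) *
                    ((real m - real CARD('n) + trace (matrix_inv A ** B) + 1) /
                     (real k - real CARD('n) + 1 + trace (matrix_inv A ** B)))
                  - ((real m - real k) * trace (matrix_inv A ** matrix_inv A ** B)) /
                    (real k - real CARD('n) + 1 + trace (matrix_inv A ** B))))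
       \<and> (int CARD('n) - \<lfloor>trace (matrix_inv A ** B)\<rfloor> \<le> int m \<longrightarrow>
           (\<exists>\<sigma>. \<sigma> \<subseteq> {1..m} \<and>
              int (card \<sigma>) = int CARD('n) - \<lfloor>trace (matrix_inv A ** B)\<rfloor> \<and>
              invertible (B + (\<Sum>i\<in>\<sigma>. Bs i)) \<and>
              trace (matrix_inv (B + (\<Sum>i\<in>\<sigma>. Bs i)))
                \<le> (real m - real CARD('n) + 1 + trace (matrix_inv A ** B)) * trace (matrix_inv A)
                  - trace (matrix_inv A ** matrix_inv A ** B) *
                    (real m - real CARD('n) + trace (matrix_inv A ** B))))"
proof -
  define T where "T = trace (matrix_inv A)"
  define t where "t = trace (matrix_inv A ** B)"
  define S where "S = trace (matrix_inv A ** matrix_inv A ** B)"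
  define n where "n = real CARD('n)"
  have "inj ((*v) A)" using assms(5) by (simp add: full_rank_injective)
  then obtain D where DA: "D ** A = mat 1" by (metis matrix_left_invertible_injective)
  hence AD: "A ** D = mat 1" by (simp add: matrix_left_right_inverse)
  note inv = matrix_inv_unique_right[OF AD]
  have symD: "transpose D = D"
  proof -
    have "A ** transpose D = mat 1"
      using arg_cong[OF DA, of transpose] psd_transpose[OF assms(1)]
      by (simp add: matrix_transpose_mul)
    hence "D ** (A ** transpose D) = D" by simp
    thus ?thesis by (simp add: matrix_mul_assoc DA)
  qed
  define V where "V = (\<Sum>i\<in>{1..m}. Bs i)"
  have V: "psd_matrix V" unfolding V_def by (intro psd_sum assms)
  \<comment> \<open>\<open>T - S\<close> is the trace of \<open>D ** V ** D\<close>.\<close>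
  have ST: "S \<le> T"
  proof -
    have "psd_matrix (D ** V ** D)" using V symD by (rule psd_conj_symmetric)
    hence "0 \<le> trace (D ** V ** D)" by (rule psd_trace_nonneg)
    also have "\<dots> = trace (D ** D ** V)"
      using trace_mul_sym[of "D ** V" D] by (simp add: matrix_mul_assoc)
    also have "\<dots> = trace (D ** (D ** A)) - trace (D ** D ** B)"
      unfolding assms(4) V_def[symmetric] by (simp add: mat_distribs trace_linear)
    finally show ?thesis by (simp add: S_def T_def inv DA)
  qed
  \<comment> \<open>\<open>n - t\<close> is the trace of \<open>D ** V\<close>. The bound makes the
    size in the second part a natural number.\<close>
  have t: "t \<le> n"
  proof -
    have "psd_matrix D" using psd_conj_symmetric[OF assms(1) symD] by (simp add: DA)
    hence "0 \<le> trace (D ** V)" using V by (rule trace_mult_nonneg)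
    also have "\<dots> = trace (D ** A) - trace (D ** B)"
      unfolding assms(4) V_def[symmetric] by (simp add: mat_distribs trace_linear)
    finally show ?thesis by (simp add: t_def n_def inv DA trace_I)
  qed
  have main: "\<exists>\<sigma>. \<sigma> \<subseteq> {1..m} \<and> card \<sigma> = k \<and> invertible (B + (\<Sum>i\<in>\<sigma>. Bs i)) \<and>
      trace (matrix_inv (B + (\<Sum>i\<in>\<sigma>. Bs i))) \<le> T + (real m - real k) * (T - S) / (real k - n + 1 + t)"
    if k: "int k \<ge> int CARD('n) - \<lfloor>t\<rfloor>" "k \<le> m" for k
    unfolding T_def S_def of_nat_diff[OF k(2), symmetric]
    by (rule subset_selection[OF _ assms(2,3,4) inv(1)])
      (use k in \<open>auto simp: n_def t_def, linarith\<close>)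
  have first: "\<exists>\<sigma>. \<sigma> \<subseteq> {1..m} \<and> card \<sigma> = k \<and> invertible (B + (\<Sum>i\<in>\<sigma>. Bs i)) \<and>
      trace (matrix_inv (B + (\<Sum>i\<in>\<sigma>. Bs i)))
        \<le> T * ((real m - n + t + 1) / (real k - n + 1 + t))
          - ((real m - real k) * S) / (real k - n + 1 + t)"
    if k: "int k \<ge> int CARD('n) - \<lfloor>t\<rfloor>" "k \<le> m" for k
  proof -
    define c where "c = real m - real k"
    define \<kappa> where "\<kappa> = real k - n + 1 + t"
    have pos: "1 \<le> \<kappa>" using k(1) unfolding n_def \<kappa>_def by linarith
    have num: "real m - n + t + 1 = c + \<kappa>" by (simp add: c_def \<kappa>_def)
    have "T + c * (T - S) / \<kappa> = T * ((c + \<kappa>) / \<kappa>) - (c * S) / \<kappa>"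
      using pos by (simp add: field_simps)
    thus ?thesis using main[OF k] unfolding num c_def[symmetric] \<kappa>_def[symmetric] by simp
  qed
  have second: "\<exists>\<sigma>. \<sigma> \<subseteq> {1..m} \<and> int (card \<sigma>) = int CARD('n) - \<lfloor>t\<rfloor> \<and>
      invertible (B + (\<Sum>i\<in>\<sigma>. Bs i)) \<and>
      trace (matrix_inv (B + (\<Sum>i\<in>\<sigma>. Bs i))) \<le> (real m - n + 1 + t) * T - S * (real m - n + t)"
    if m: "int CARD('n) - \<lfloor>t\<rfloor> \<le> int m"
  proof -
    have "real_of_int \<lfloor>t\<rfloor> \<le> n" using t of_int_floor_le[of t] by linarith
    hence "0 \<le> int CARD('n) - \<lfloor>t\<rfloor>" unfolding n_def by linarith
    then obtain k where k: "int k = int CARD('n) - \<lfloor>t\<rfloor>" by (metis nonneg_int_cases)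
    \<comment> \<open>For this \<open>k\<close>, \<open>\<kappa> - 1\<close> is the fractional part
      of \<open>t\<close>.\<close>
    define \<kappa> where "\<kappa> = real k - n + 1 + t"
    have \<kappa>: "1 \<le> \<kappa>" using k unfolding n_def \<kappa>_def by linarith
    have km: "k \<le> m" using k m by linarith
    define c where "c = real m - real k"
    from main[of k] k km obtain \<sigma> where \<sigma>: "\<sigma> \<subseteq> {1..m}" "card \<sigma> = k" "invertible (B + (\<Sum>i\<in>\<sigma>. Bs i))"
      "trace (matrix_inv (B + (\<Sum>i\<in>\<sigma>. Bs i))) \<le> T + c * (T - S) / \<kappa>"
      unfolding \<kappa>_def c_def by auto
    note \<sigma>(4)
    \<comment> \<open>Dropping the denominator \<open>\<kappa> \<ge> 1\<close> and then adding
      \<open>\<kappa> - 1\<close> to \<open>c\<close> both rely on \<open>ST\<close>. The resulting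
      factor \<open>c + (\<kappa> - 1)\<close> is \<open>real m - n + t\<close>, free of the
      floor.\<close>
    also have "c * (T - S) / \<kappa> \<le> c * (T - S)"
    proof -
      have "c * (T - S) * 1 \<le> c * (T - S) * \<kappa>"
        using \<kappa> km ST by (intro mult_left_mono) (auto simp: c_def)
      thus ?thesis using \<kappa> by (simp add: pos_divide_le_eq)
    qed
    also have "c * (T - S) \<le> (c + (\<kappa> - 1)) * (T - S)"
      using \<kappa> ST by (intro mult_right_mono) auto
    also have "T + (c + (\<kappa> - 1)) * (T - S) = (real m - n + 1 + t) * T - S * (real m - n + t)"
      by (simp add: c_def \<kappa>_def algebra_simps)
    finally show ?thesis using \<sigma> k by (intro exI[of _ \<sigma>]) auto
  qed
  show ?thesis
    using first second unfolding T_def[symmetric] t_def[symmetric] S_def[symmetric] n_def[symmetric]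
    by blast
qed

end
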